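(* Let $(X,d)$ be a metric space, $\mathcal{B}$ its ball cover, $P$ a persistent clique partition of $X$, and $\mathcal{B}_P$ the pullback of the quotient ball cover. Then $\mathcal{B}$ and $\mathcal{B}_P$ are $2$-approximated (up to contiguity); that is, for every $r\in\mathbb{R}_+$ there exist refinement maps $$f_r:\mathcal{B}(r)\to\mathcal{B}_P(r)\qquad\text{and}\qquad g_r:\mathcal{B}_P(r)\to\mathcal{B}(2r).$$
   Context: $\mathbb{R}_+=[0,\infty)$. A cover of a set $X$ is an indexed family $\mathcal{U}=\{U_i\}_{i\in I}$ of sets with $X=\bigcup_{i\in I}U_i$. A refinement map $\{V_j\}_{j\in J}\to\{U_i\}_{i\in I}$ is a function $f:J\to I$ with $V_j\subseteq U_{f(j)}$ for all $j$. The ball cover at scale $r$ is $\mathcal{B}(r)=\{B(x,r)\}_{x\in X}$, where $B(x,r)=\{y\in X:d(x,y)\le r\}$. A persistent clique partition $P$ of $X$ assigns to each $r\in\mathbb{R}_+$ a partition $P(r)$ of $X$ (into nonempty blocks) such that every block $C\in P(r)$ has $\mathrm{diam}(C)\le r$, and for $s\le t$ every block of $P(s)$ is contained in a block of $P(t)$. Let $q_r:X\to X/P(r)$ be the projection to the set of blocks. The pullback of the quotient ball cover is the cover of $X$ $$\mathcal{B}_P(r)=\{q_r^{-1}(q_r(B(x,r)))\}_{x\in X}.$$ Families of covers $\mathcal{U}(r),\mathcal{V}(r)$ of $X$ (each increasing under refinement as $r$ grows) are $c$-approximated up to contiguity if for every $r$ there exist refinement maps $\mathcal{U}(r)\to\mathcal{V}(cr)$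 and $\mathcal{V}(r)\to\mathcal{U}(cr)$. *)

theory Defs
  imports "HOL-Analysis.Analysis" "HOL-Library.Disjoint_Sets"
begin

text \<open>
  An indexed family of subsets is a pair of an index set and a function on it. Scales are
  reals; only the values at \<open>r \<ge> 0\<close> of anything indexed by a scale are ever used.
\<close>

type_synonym ('i, 'a) family = "'i set \<times> ('i \<Rightarrow> 'a set)"

definition is_cover :: "'a set \<Rightarrow> ('i, 'a) family \<Rightarrow> bool" where
  "is_cover X U \<longleftrightarrow> X = (\<Union>i\<in>fst U. snd U i)"

definition refinement_map :: "('j, 'a) family \<Rightarrow> ('i, 'a) family \<Rightarrow> ('j \<Rightarrow> 'i) \<Rightarrow> bool" where
  "refinement_map V U f \<longleftrightarrow> f \<in> fst V \<rightarrow> fst U \<and> (\<forall>j\<in>fst V. snd V j \<subseteq> snd U (f j))"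

definition increasing_covers :: "'a set \<Rightarrow> (real \<Rightarrow> ('i, 'a) family) \<Rightarrow> bool" where
  "increasing_covers X U \<longleftrightarrow>
     (\<forall>r\<ge>0. is_cover X (U r)) \<and>
     (\<forall>s t. 0 \<le> s \<longrightarrow> s \<le> t \<longrightarrow> (\<exists>f. refinement_map (U s) (U t) f))"

definition approximated_up_to_contiguity ::
    "'a set \<Rightarrow> real \<Rightarrow> (real \<Rightarrow> ('i, 'a) family) \<Rightarrow> (real \<Rightarrow> ('j, 'a) family) \<Rightarrow> bool" where
  "approximated_up_to_contiguity X c U V \<longleftrightarrow>
     increasing_covers X U \<and> increasing_covers X V \<and>
     (\<forall>r\<ge>0. (\<exists>f. refinement_map (U r) (V (c * r)) f) \<and>
             (\<exists>g. refinement_map (V r) (U (c * r)) g))"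

definition ball_cover :: "'a set \<Rightarrow> ('a \<Rightarrow> 'a \<Rightarrow> real) \<Rightarrow> real \<Rightarrow> ('a, 'a) family" where
  "ball_cover X d r = (X, \<lambda>x. Metric_space.mcball X d x r)"

text \<open>
  The diameter takes values in \<open>[0, \<infinity>]\<close>: unlike the real-valued library constant
  \<^const>\<open>diameter\<close>, it is meaningful for unbounded sets, so that \<open>diam C \<le> r\<close> entails
  boundedness.
\<close>

definition ediam :: "('a \<Rightarrow> 'a \<Rightarrow> real) \<Rightarrow> 'a set \<Rightarrow> ennreal" where
  "ediam d C = (SUP (x, y)\<in>C \<times> C. ennreal (d x y))"

text \<open>
  \<^const>\<open>refines\<close> says that both arguments are partitions of \<open>X\<close> and that every block of the
  first is contained in a block of the second.
\<close>

definition persistent_clique_partition ::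
    "'a set \<Rightarrow> ('a \<Rightarrow> 'a \<Rightarrow> real) \<Rightarrow> (real \<Rightarrow> 'a set set) \<Rightarrow> bool" where
  "persistent_clique_partition X d P \<longleftrightarrow>
     (\<forall>r\<ge>0. partition_on X (P r) \<and> (\<forall>C\<in>P r. ediam d C \<le> ennreal r)) \<and>
     (\<forall>s t. 0 \<le> s \<longrightarrow> s \<le> t \<longrightarrow> refines X (P s) (P t))"

definition block_proj :: "'a set set \<Rightarrow> 'a \<Rightarrow> 'a set" where
  "block_proj Q x = (THE C. C \<in> Q \<and> x \<in> C)"

definition pullback_ball_cover ::
    "'a set \<Rightarrow> ('a \<Rightarrow> 'a \<Rightarrow> real) \<Rightarrow> (real \<Rightarrow> 'a set set) \<Rightarrow> real \<Rightarrow> ('a, 'a) family" where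
  "pullback_ball_cover X d P r =
     (X, \<lambda>x. X \<inter> block_proj (P r) -` (block_proj (P r) ` Metric_space.mcball X d x r))"

end

theory Submission
  imports Defs
begin

text \<open>
  Every refinement map can be taken to be the identity on centres. A point of the pullback of the
  quotient ball at \<open>x\<close> shares a block of \<open>P r\<close>, hence lies at distance at most \<open>r\<close>, with some
  point of \<open>B(x, r)\<close>, so it belongs to \<open>B(x, 2r)\<close>.
\<close>

text \<open>Distinct blocks of a partition are disjoint, so the definite description in
  \<open>block_proj\<close> has a single candidate.\<close>

lemma block_proj_eqI:
  assumes "partition_on X Q" "C \<in> Q" "x \<in> C"
  shows "block_proj Q x = C"
  unfolding block_proj_def
proof (rule the_equality)
  fix D assume "D \<in> Q \<and> x \<in> D"
  with assms show "D = C"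
    by (auto dest!: partition_onD2 dest: disjointD)
qed (use assms in simp)

lemma block_proj_eq_iff:
  assumes "partition_on X Q" "x \<in> X" "y \<in> X"
  shows "block_proj Q x = block_proj Q y \<longleftrightarrow> (\<exists>C\<in>Q. x \<in> C \<and> y \<in> C)"
proof -
  obtain C D where "C \<in> Q" "x \<in> C" "D \<in> Q" "y \<in> D"
    using assms partition_onD1 by blast
  then show ?thesis
    using block_proj_eqI[OF assms(1)] by metis
qed

text \<open>Each distance is one of the terms of the supremum. The sign condition on
  \<open>r\<close> allows the return to the reals, since \<open>ennreal\<close> sends negative
  numbers to 0.\<close>

lemma dist_le_of_ediam_le:
  assumes "ediam d C \<le> ennreal r" "0 \<le> r" "x \<in> C" "y \<in> C"
  shows "d x y \<le> r"
proof -
  have "ennreal (d x y) \<le> ediam d C"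
    unfolding ediam_def using assms by (intro SUP_upper2[of "(x, y)"]) auto
  with assms have "ennreal (d x y) \<le> ennreal r"
    by (rule_tac order_trans)
  then show ?thesis
    using assms(2) by (simp add: ennreal_le_iff)
qed

lemma refinement_mapI_id:
  assumes "fst V = fst U" "\<And>j. j \<in> fst V \<Longrightarrow> snd V j \<subseteq> snd U j"
  shows "\<exists>f. refinement_map V U f"
  using assms by (intro exI[of _ "\<lambda>j. j"]) (auto simp: refinement_map_def)

context Metric_space
begin

lemma increasing_covers_ball_cover: "increasing_covers M (ball_cover M d)"
  unfolding increasing_covers_def
proof (intro conjI allI impI)
  fix r :: real assume "0 \<le> r"
  \<comment> \<open>For \<open>r \<ge> 0\<close>, even \<open>r = 0\<close>, every point lies in the
    closed ball around itself.\<close>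
  then show "is_cover M (ball_cover M d r)"
    by (auto simp: is_cover_def ball_cover_def)
next
  fix s t :: real assume "s \<le> t"
  then show "\<exists>f. refinement_map (ball_cover M d s) (ball_cover M d t) f"
    by (intro refinement_mapI_id) (auto simp: ball_cover_def)
qed

text \<open>Trades \<open>block_proj\<close> for a common block \<open>C\<close>, the form to which
  the diameter bound and the refinement of partitions apply.\<close>

lemma mem_pullback_ball_cover_iff:
  assumes "persistent_clique_partition M d P" "0 \<le> r"
  shows "y \<in> snd (pullback_ball_cover M d P r) x \<longleftrightarrow>
    (\<exists>C\<in>P r. \<exists>z\<in>C. y \<in> C \<and> z \<in> mcball x r)"
proof -
  have part: "partition_on M (P r)"
    using assms by (auto simp: persistent_clique_partition_def)
  then have sub: "C \<subseteq> M" if "C \<in> P r" for C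
    using that partition_onD1 by blast
  have "y \<in> snd (pullback_ball_cover M d P r) x \<longleftrightarrow>
      y \<in> M \<and> (\<exists>z\<in>mcball x r. block_proj (P r) y = block_proj (P r) z)"
    unfolding pullback_ball_cover_def by (simp add: image_iff del: in_mcball)
  also have "\<dots> \<longleftrightarrow> y \<in> M \<and> (\<exists>z\<in>mcball x r. \<exists>C\<in>P r. y \<in> C \<and> z \<in> C)"
    \<comment> \<open>Both points are in the carrier: \<open>y\<close> by the first conjunct,
      \<open>z\<close> because balls lie in \<open>M\<close>.\<close>
    using block_proj_eq_iff[OF part] mcball_subset_mspace by (metis subsetD)
  also have "\<dots> \<longleftrightarrow> (\<exists>C\<in>P r. \<exists>z\<in>C. y \<in> C \<and> z \<in> mcball x r)"
    using sub by blast
  finally show ?thesis .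
qed

text \<open>A set lies in the preimage of its own image, and balls lie in \<open>M\<close>.\<close>

lemma mcball_subset_pullback: "mcball x r \<subseteq> snd (pullback_ball_cover M d P r) x"
  by (auto simp: pullback_ball_cover_def)

lemma pullback_subset_mcball:
  assumes "persistent_clique_partition M d P" "0 \<le> r"
  shows "snd (pullback_ball_cover M d P r) x \<subseteq> mcball x (2 * r)"
proof
  fix y assume "y \<in> snd (pullback_ball_cover M d P r) x"
  then obtain C z where C: "C \<in> P r" "z \<in> C" "y \<in> C" and z: "z \<in> mcball x r"
    using mem_pullback_ball_cover_iff[OF assms] by blast
  have "C \<subseteq> M" "ediam d C \<le> ennreal r"
    using assms C unfolding persistent_clique_partition_def by (blast dest: partition_onD1)+
  then have "y \<in> M" "d z y \<le> r"
    using C assms(2) dist_le_of_ediam_le[of d C r z y] by auto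
  then show "y \<in> mcball x (2 * r)"
    \<comment> \<open>The factor 2 arises here: one \<open>r\<close> is the radius of the ball, the
      other the diameter bound of the block.\<close>
    using z triangle[of x z y] by auto
qed

text \<open>The same witness \<open>z\<close> serves at both scales: its block at \<open>s\<close>
  sits inside a block at \<open>t\<close>, and the ball only grows.\<close>

lemma pullback_mono:
  assumes "persistent_clique_partition M d P" "0 \<le> s" "s \<le> t"
  shows "snd (pullback_ball_cover M d P s) x \<subseteq> snd (pullback_ball_cover M d P t) x"
proof
  fix y assume "y \<in> snd (pullback_ball_cover M d P s) x"
  then obtain C z where C: "C \<in> P s" "z \<in> C" "y \<in> C" "z \<in> mcball x s"
    using mem_pullback_ball_cover_iff assms by blast
  moreover obtain D where "D \<in> P t" "C \<subseteq> D"
    using assms C unfolding persistent_clique_partition_def refines_def by blast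
  moreover have "mcball x s \<subseteq> mcball x t"
    using assms by auto
  ultimately show "y \<in> snd (pullback_ball_cover M d P t) x"
    using mem_pullback_ball_cover_iff[OF assms(1), of t] assms by (meson order_trans subsetD)
qed

lemma increasing_covers_pullback:
  assumes "persistent_clique_partition M d P"
  shows "increasing_covers M (pullback_ball_cover M d P)"
  unfolding increasing_covers_def
proof (intro conjI allI impI)
  fix r :: real assume "0 \<le> r"
  then show "is_cover M (pullback_ball_cover M d P r)"
    by (force simp: is_cover_def pullback_ball_cover_def)
next
  fix s t :: real assume "0 \<le> s" "s \<le> t"
  then show "\<exists>f. refinement_map (pullback_ball_cover M d P s) (pullback_ball_cover M d P t) f"
    using pullback_mono[OF assms]
    by (intro refinement_mapI_id) (auto simp: pullback_ball_cover_def)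
qed

end

theorem theorem4p18:
  fixes X :: "'a set" and d :: "'a \<Rightarrow> 'a \<Rightarrow> real" and P :: "real \<Rightarrow> 'a set set"
  assumes "Metric_space X d"
    and "persistent_clique_partition X d P"
  shows "approximated_up_to_contiguity X 2 (ball_cover X d) (pullback_ball_cover X d P) \<and>
    (\<forall>r\<ge>0. (\<exists>f. refinement_map (ball_cover X d r) (pullback_ball_cover X d P r) f) \<and>
            (\<exists>g. refinement_map (pullback_ball_cover X d P r) (ball_cover X d (2 * r)) g))"
proof -
  interpret Metric_space X d by fact
  note P = assms(2)
  have fst_simps [simp]: "fst (ball_cover X d r) = X" "fst (pullback_ball_cover X d P r) = X" for r
    by (simp_all add: ball_cover_def pullback_ball_cover_def)
  have snd_ball [simp]: "snd (ball_cover X d r) x = mcball x r" for r x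
    by (simp add: ball_cover_def)
  \<comment> \<open>The target scale is left free because two values are used: \<open>t = r\<close>
    for the sharper claim on \<open>f\<close>, and \<open>t = 2 * r\<close> for the symmetric notion
    of approximation.\<close>
  have f: "\<exists>f. refinement_map (ball_cover X d r) (pullback_ball_cover X d P t) f"
    if "0 \<le> r" "r \<le> t" for r t
  proof (rule refinement_mapI_id)
    show "snd (ball_cover X d r) x \<subseteq> snd (pullback_ball_cover X d P t) x" for x
      using mcball_subset_pullback[of x r P] pullback_mono[OF P that] by auto
  qed simp
  have g: "\<exists>g. refinement_map (pullback_ball_cover X d P r) (ball_cover X d (2 * r)) g"
    if "0 \<le> r" for r
    using pullback_subset_mcball[OF P that] by (intro refinement_mapI_id) simp_all
  show ?thesis
    using f g increasing_covers_ball_cover increasing_covers_pullback[OF P]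
    by (simp add: approximated_up_to_contiguity_def)
qed

end
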